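(* The functor ${}^\bullet(-):\mathbf{Diff}\to{}^\bullet\mathcal C^\infty$ makes every diffeological space a subset of the corresponding Fermat space: for every diffeological space $X$, the canonical map $i_X:|X|\to|{}^\bullet X|$ is injective.
   Context: FERMAT EXTENSIONS. For $U\subseteq\mathbb R^n$ open, a little-oh polynomial on $U$ is a function $x:[0,\epsilon)\to U$ (some $\epsilon>0$, not fixed) such that for some $r\in U$, $k\in\mathbb N$, $\alpha_i\in\mathbb R^n$, $a_i>0$ one has $x(0)=r$ and $\|x(t)-r-\sum_{i=1}^k\alpha_it^{a_i}\|=o(t)$ as $t\to0^+$. Two such $x,y$ are equivalent if $x(0)=y(0)$ and $x(t)-y(t)=o(t)$; ${}^\bullet U$ is the set of equivalence classes, and ${}^\circ x:=x(0)\in U$ is the standard part. Identify ${}^\bullet U=\{x\in{}^\bullet\mathbb R^n: {}^\circ x\in U\}$ and ${}^\bullet(U\times V)={}^\bullet U\times{}^\bullet V$. The map $i_U:U\to{}^\bullet U$ sends $u$ to the class of the constant function $u$. A smooth map $f:U\to V$ of open subsets of Euclidean spaces has the Fermat extension ${}^\bullet f:{}^\bullet U\to{}^\bullet V$, $[x]\mapsto[f\circ x]$; it satisfies ${}^\bullet f\circ i_U=i_V\circ f$. The Fermat topology on ${}^\bullet\mathbb R^n$ has as open sets exactly the ${}^\bullet U$ with $U\subseteq\mathbb R^n$ open; subsets carry the subspace topology. For $A\subseteq{}^\bullet\mathbb R^n$, $B\subseteq{}^\bullet\mathbb R^m$, a function $f:A\to B$ is quasi-standard smooth if for every $a\in A$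 there are an open neighborhood $U$ of ${}^\circ a$ in $\mathbb R^n$, an open subset $P$ of a Euclidean space, a smooth map $\alpha:P\times U\to\mathbb R^m$ and a point $p\in{}^\bullet P$ with $f(x)={}^\bullet\alpha(p,x)$ for all $x\in A\cap{}^\bullet U$. SITES AND SPACES. $\mathcal S$ is the site of all open subsets of all $\mathbb R^n$, $n\in\mathbb N$, with smooth maps and usual open coverings. $\mathcal F$ is the site of all subsets of all ${}^\bullet\mathbb R^n$, with quasi-standard smooth maps and coverings by Fermat-open subsets. For $\mathcal A=\mathcal S$ or $\mathcal F$, a concrete sheaf $X$ over $\mathcal A$ is a set $|X|$ with, for each object $A$ of $\mathcal A$, a collection of functions $A\to|X|$ called sections, such that constant functions are sections, sections are stable under precomposition with morphisms of $\mathcal A$, and a function that is a section on each member of a cover of $A$ is a section. Morphisms are functions sending sections to sections by composition. Concrete sheaves over $\mathcal S$ are the diffeological spaces (sections: plots; morphisms: smooth maps; category $\mathbf{Diff}$); those over $\mathcal F$ are the Fermat spaces (sections: Fermat plots; morphisms: Fermat maps; category ${}^\bullet\mathcal C^\infty$). Each object of $\mathcal A$ is a concrete sheaf whose sections are the morphisms of $\mathcal A$ into it. A colimit of concrete sheaves has as underlying set the colimit of underlying sets, and its sections are the functions that locally (on a cover) factor through sections of members of the diagram. ADDING INFINITESIMALS. For a diffeological space $X$, $\mathcal S/X$ has as objects the plots $p:U\to X$ and as morphisms from $p:U\to X$ to $q:V\to X$ the smooth maps $f:U\to V$ with $q\circ f=p$; one has $X=\operatorname{colim}_{U\in\mathcal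 S/X}U$ in $\mathbf{Diff}$. The Fermat space ${}^\bullet X$ is $\operatorname{colim}_{U\in\mathcal S/X}{}^\bullet U$ in ${}^\bullet\mathcal C^\infty$ (with transition maps ${}^\bullet f$). So points of ${}^\bullet X$ are classes of pairs $(p:U\to X,\,u\in{}^\bullet U)$ under the equivalence relation generated by $(p,u)\sim(q,{}^\bullet f(u))$ when $q\circ f=p$. A smooth map $g:X\to Y$ induces ${}^\bullet g$ by $[p,u]\mapsto[g\circ p,u]$. The map $i_X:|X|\to|{}^\bullet X|$ is the map induced on colimits by the $i_U$, i.e. $p(u)\mapsto[p,i_U(u)]$ for $u\in U$. *)

theory Defs
  imports "HOL-Analysis.Analysis" "HOL-Library.Landau_Symbols"
begin

section \<open>Euclidean spaces and smooth maps\<close>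

text \<open>
  Since the dimension is a variable, $\mathbb{R}^n$ is the topological space
  \<^term>\<open>Euclidean_space n\<close> of the library: functions on the naturals that vanish from
  index \<open>n\<close> on.  Maps between subsets are total HOL functions of which only the values on
  the stated domain matter.
\<close>

type_synonym rvec = "nat \<Rightarrow> real"

abbreviation Rn :: "nat \<Rightarrow> rvec set"
  where "Rn n \<equiv> topspace (Euclidean_space n)"

definition vnorm :: "nat \<Rightarrow> rvec \<Rightarrow> real"
  where "vnorm n v = L2_set v {..<n}"

text \<open>\<open>Ck n k U f\<close>: all iterated partial derivatives of order at most \<open>k\<close> of \<open>f\<close> exist and are
  continuous on the open set \<open>U\<close>.\<close>

primrec Ck :: "nat \<Rightarrow> nat \<Rightarrow> rvec set \<Rightarrow> (rvec \<Rightarrow> real) \<Rightarrow> bool" where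
  "Ck n 0 U f \<longleftrightarrow> continuous_on U f"
| "Ck n (Suc k) U f \<longleftrightarrow> continuous_on U f \<and>
     (\<forall>i<n. \<exists>g. Ck n k U g \<and>
        (\<forall>x\<in>U. ((\<lambda>s. f (x(i := s))) has_real_derivative g x) (at (x i))))"

definition smooth_map :: "nat \<Rightarrow> rvec set \<Rightarrow> nat \<Rightarrow> rvec set \<Rightarrow> (rvec \<Rightarrow> rvec) \<Rightarrow> bool"
  where "smooth_map n U m V f \<longleftrightarrow> f \<in> U \<rightarrow> V \<and> (\<forall>j<m. \<forall>k. Ck n k U (\<lambda>x. f x j))"

text \<open>Identification of $\mathbb{R}^l\times\mathbb{R}^n$ with $\mathbb{R}^{l+n}$.\<close>

definition vcat :: "nat \<Rightarrow> rvec \<Rightarrow> rvec \<Rightarrow> rvec"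
  where "vcat l v w = (\<lambda>i. if i < l then v i else w (i - l))"

definition vprod :: "nat \<Rightarrow> rvec set \<Rightarrow> rvec set \<Rightarrow> rvec set"
  where "vprod l P U = {vcat l v w | v w. v \<in> P \<and> w \<in> U}"


section \<open>Fermat extensions\<close>

text \<open>A function \<open>[0,\<epsilon>) \<rightarrow> U\<close> with unspecified \<open>\<epsilon> > 0\<close> is represented by a total function whose
  values off \<open>[0,\<epsilon>)\<close> are irrelevant.  Note that \<open>0 powr a = 0\<close>.\<close>

definition little_oh_poly :: "nat \<Rightarrow> rvec set \<Rightarrow> (real \<Rightarrow> rvec) \<Rightarrow> bool" where
  "little_oh_poly n U x \<longleftrightarrow>
     (\<exists>\<epsilon>>0. \<forall>t\<in>{0..<\<epsilon>}. x t \<in> U) \<and>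
     (\<exists>r\<in>U. \<exists>(k::nat) (\<alpha>::nat \<Rightarrow> rvec) (a::nat \<Rightarrow> real).
        (\<forall>i\<in>{1..k}. \<alpha> i \<in> Rn n \<and> a i > 0) \<and> x 0 = r \<and>
        (\<lambda>t. vnorm n (\<lambda>j. x t j - r j - (\<Sum>i=1..k. \<alpha> i j * t powr a i)))
          \<in> o[at_right 0](\<lambda>t. t))"

type_synonym fpoint = "(real \<Rightarrow> rvec) set"

definition fermat_rel :: "nat \<Rightarrow> ((real \<Rightarrow> rvec) \<times> (real \<Rightarrow> rvec)) set" where
  "fermat_rel n = {(x, y). little_oh_poly n (Rn n) x \<and> little_oh_poly n (Rn n) y \<and>
     x 0 = y 0 \<and> (\<lambda>t. vnorm n (\<lambda>j. x t j - y t j)) \<in> o[at_right 0](\<lambda>t. t)}"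

text \<open>Classes are always taken in $\mathbb{R}^n$; this builds in the identification of the
  extension of \<open>U\<close> with a subset of the extension of $\mathbb{R}^n$
  (see \<open>fermat_eq_std\<close> below).\<close>

definition fermat :: "nat \<Rightarrow> rvec set \<Rightarrow> fpoint set"
  where "fermat n U = {x. little_oh_poly n U x} // fermat_rel n"

definition std :: "fpoint \<Rightarrow> rvec"
  where "std c = (THE r. \<exists>x\<in>c. x 0 = r)"

definition fermat_const :: "nat \<Rightarrow> rvec \<Rightarrow> fpoint"
  where "fermat_const n u = fermat_rel n `` {\<lambda>_. u}"

text \<open>The class of \<open>f \<circ> x\<close>, where \<open>x\<close> represents \<open>c\<close> and \<open>f\<close> takes values in $\mathbb{R}^m$.\<close>

definition fermat_fun :: "nat \<Rightarrow> (rvec \<Rightarrow> rvec) \<Rightarrow> fpoint \<Rightarrow> fpoint"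
  where "fermat_fun m f c = (\<Union>x\<in>c. fermat_rel m `` {f \<circ> x})"

definition fermat_pair :: "nat \<Rightarrow> nat \<Rightarrow> fpoint \<Rightarrow> fpoint \<Rightarrow> fpoint"
  where "fermat_pair l n c d =
    (\<Union>x\<in>c. \<Union>y\<in>d. fermat_rel (l + n) `` {\<lambda>t. vcat l (x t) (y t)})"

definition quasi_standard_smooth ::
  "nat \<Rightarrow> fpoint set \<Rightarrow> nat \<Rightarrow> fpoint set \<Rightarrow> (fpoint \<Rightarrow> fpoint) \<Rightarrow> bool" where
  "quasi_standard_smooth n A m B f \<longleftrightarrow> f \<in> A \<rightarrow> B \<and>
     (\<forall>a\<in>A. \<exists>U l P \<alpha> p.
        openin (Euclidean_space n) U \<and> std a \<in> U \<and> openin (Euclidean_space l) P \<and>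
        smooth_map (l + n) (vprod l P U) m (Rn m) \<alpha> \<and> p \<in> fermat l P \<and>
        (\<forall>x\<in>A \<inter> fermat n U. f x = fermat_fun m \<alpha> (fermat_pair l n p x)))"


section \<open>Concrete sheaves\<close>

text \<open>An object of a site is a pair of a dimension and a set of points; a cover is a family of
  subobjects of the same dimension.\<close>

record 'p site =
  Obj :: "(nat \<times> 'p set) set"
  Hom :: "nat \<times> 'p set \<Rightarrow> nat \<times> 'p set \<Rightarrow> ('p \<Rightarrow> 'p) set"
  Cov :: "nat \<times> 'p set \<Rightarrow> 'p set set set"

definition euclidean_site :: "rvec site" where
  "euclidean_site = \<lparr>
     Obj = {(n, U). openin (Euclidean_space n) U},
     Hom = \<lambda>(n, U) (m, V). {f. smooth_map n U m V f},
     Cov = \<lambda>(n, U). {\<C>. (\<forall>W\<in>\<C>. openin (Euclidean_space n) W) \<and> \<Union>\<C> = U}\<rparr>"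

definition fermat_site :: "fpoint site" where
  "fermat_site = \<lparr>
     Obj = {(n, A). A \<subseteq> fermat n (Rn n)},
     Hom = \<lambda>(n, A) (m, B). {f. quasi_standard_smooth n A m B f},
     Cov = \<lambda>(n, A). {\<C>. (\<forall>B\<in>\<C>. \<exists>W. openin (Euclidean_space n) W \<and> B = A \<inter> fermat n W)
                          \<and> \<Union>\<C> = A}\<rparr>"

record ('p, 'a) sheaf_data =
  points :: "'a set"
  sections :: "nat \<times> 'p set \<Rightarrow> ('p \<Rightarrow> 'a) set"

locale concrete_sheaf =
  fixes S :: "'p site" and X :: "('p, 'a) sheaf_data"
  assumes sections_into: "A \<in> Obj S \<Longrightarrow> sections X A \<subseteq> snd A \<rightarrow>\<^sub>E points X"
    and sections_const:
      "A \<in> Obj S \<Longrightarrow> c \<in> points X \<Longrightarrow> restrict (\<lambda>_. c) (snd A) \<in> sections X A"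
    and sections_comp:
      "A \<in> Obj S \<Longrightarrow> B \<in> Obj S \<Longrightarrow> f \<in> Hom S A B \<Longrightarrow> s \<in> sections X B \<Longrightarrow>
        restrict (s \<circ> f) (snd A) \<in> sections X A"
    and sections_glue:
      "A \<in> Obj S \<Longrightarrow> \<C> \<in> Cov S A \<Longrightarrow> s \<in> snd A \<rightarrow>\<^sub>E points X \<Longrightarrow>
        (\<And>B. B \<in> \<C> \<Longrightarrow> restrict s B \<in> sections X (fst A, B)) \<Longrightarrow> s \<in> sections X A"

abbreviation diffeological_space :: "(rvec, 'a) sheaf_data \<Rightarrow> bool"
  where "diffeological_space \<equiv> concrete_sheaf euclidean_site"

abbreviation fermat_space :: "(fpoint, 'a) sheaf_data \<Rightarrow> bool"
  where "fermat_space \<equiv> concrete_sheaf fermat_site"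


section \<open>The Fermat space of a diffeological space\<close>

type_synonym 'a plot = "(nat \<times> rvec set) \<times> (rvec \<Rightarrow> 'a)"

definition plots :: "(rvec, 'a) sheaf_data \<Rightarrow> 'a plot set"
  where "plots X = (SIGMA A : Obj euclidean_site. sections X A)"

definition plot_hom :: "'a plot \<Rightarrow> 'a plot \<Rightarrow> (rvec \<Rightarrow> rvec) set" where
  "plot_hom = (\<lambda>(A, p) (B, q). {f \<in> Hom euclidean_site A B. \<forall>u\<in>snd A. q (f u) = p u})"

text \<open>The disjoint union, over all plots, of the Fermat extensions of their domains.\<close>

definition plot_points :: "(rvec, 'a) sheaf_data \<Rightarrow> ('a plot \<times> fpoint) set"
  where "plot_points X = (SIGMA P : plots X. case P of ((n, U), p) \<Rightarrow> fermat n U)"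

definition plot_step :: "(rvec, 'a) sheaf_data \<Rightarrow> (('a plot \<times> fpoint) \<times> ('a plot \<times> fpoint)) set"
  where "plot_step X = {((P, u), (Q, v)). (P, u) \<in> plot_points X \<and> (Q, v) \<in> plot_points X \<and>
     (\<exists>f\<in>plot_hom P Q. v = fermat_fun (fst (fst Q)) f u)}"

definition plot_equiv :: "(rvec, 'a) sheaf_data \<Rightarrow> (('a plot \<times> fpoint) \<times> ('a plot \<times> fpoint)) set"
  where "plot_equiv X = (plot_step X \<union> (plot_step X)\<inverse>)\<^sup>*"

definition plot_class :: "(rvec, 'a) sheaf_data \<Rightarrow> 'a plot \<Rightarrow> fpoint \<Rightarrow> ('a plot \<times> fpoint) set"
  where "plot_class X P u = plot_equiv X `` {(P, u)}"

text \<open>The colimit, over all plots of \<open>X\<close>, of the Fermat extensions of their domains: its sections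
  are the functions that locally factor through a quasi-standard smooth map into one of them.\<close>

definition fermat_ext :: "(rvec, 'a) sheaf_data \<Rightarrow> (fpoint, ('a plot \<times> fpoint) set) sheaf_data" where
  "fermat_ext X = (let E = plot_points X // plot_equiv X in \<lparr>
     points = E,
     sections = \<lambda>(n, A). {s \<in> A \<rightarrow>\<^sub>E E. \<exists>\<C>\<in>Cov fermat_site (n, A). \<forall>B\<in>\<C>.
        \<exists>m V p. ((m, V), p) \<in> plots X \<and>
          (\<exists>h\<in>Hom fermat_site (n, B) (m, fermat m V).
             \<forall>b\<in>B. s b = plot_class X ((m, V), p) (h b))}\<rparr>)"

text \<open>The map \<open>p(u) \<mapsto> [p, i\<^sub>U(u)]\<close>; the union is over equal classes by
  \<open>canonical_map_plot\<close> below.\<close>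

definition canonical_map :: "(rvec, 'a) sheaf_data \<Rightarrow> 'a \<Rightarrow> ('a plot \<times> fpoint) set" where
  "canonical_map X x =
     \<Union>{plot_class X ((n, U), p) (fermat_const n u) | n U p u.
         ((n, U), p) \<in> plots X \<and> u \<in> U \<and> p u = x}"


subsection \<open>Well-definedness\<close>

lemma vnorm_nonneg: "0 \<le> vnorm n v"
  by (simp add: vnorm_def)

lemma vnorm_zero [simp]: "vnorm n (\<lambda>_. 0) = 0"
  by (simp add: vnorm_def L2_set_def)

lemma vnorm_minus_commute: "vnorm n (\<lambda>j. v j - w j) = vnorm n (\<lambda>j. w j - v j)"
  by (simp add: vnorm_def L2_set_def power2_commute)

lemma vnorm_triangle: "vnorm n (\<lambda>j. v j - z j) \<le> vnorm n (\<lambda>j. v j - w j) + vnorm n (\<lambda>j. w j - z j)"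
  using L2_set_triangle_ineq[of "\<lambda>j. v j - w j" "\<lambda>j. w j - z j" "{..<n}"]
  by (simp add: vnorm_def)

lemma equiv_fermat_rel: "equiv {x. little_oh_poly n (Rn n) x} (fermat_rel n)"
proof (rule equivI)
  show "fermat_rel n \<subseteq> {x. little_oh_poly n (Rn n) x} \<times> {x. little_oh_poly n (Rn n) x}"
    by (auto simp: fermat_rel_def)
  show "refl_on {x. little_oh_poly n (Rn n) x} (fermat_rel n)"
    by (auto simp: refl_on_def fermat_rel_def)
  show "sym (fermat_rel n)"
  proof (rule symI)
    fix x y assume "(x, y) \<in> fermat_rel n"
    then show "(y, x) \<in> fermat_rel n"
      by (simp add: fermat_rel_def vnorm_minus_commute[of n "y _"])
  qed
  show "trans (fermat_rel n)"
  proof (rule transI)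
    fix x y z assume xy: "(x, y) \<in> fermat_rel n" and yz: "(y, z) \<in> fermat_rel n"
    have "(\<lambda>t. vnorm n (\<lambda>j. x t j - y t j) + vnorm n (\<lambda>j. y t j - z t j)) \<in> o[at_right 0](\<lambda>t. t)"
      using xy yz by (intro sum_in_smallo) (auto simp: fermat_rel_def)
    then have "(\<lambda>t. vnorm n (\<lambda>j. x t j - z t j)) \<in> o[at_right 0](\<lambda>t. t)"
      by (rule landau_o.big_small_trans[rotated])
        (intro bigoI[where c = 1] always_eventually allI,
         simp add: vnorm_nonneg vnorm_triangle abs_of_nonneg)
    with xy yz show "(x, z) \<in> fermat_rel n"
      by (auto simp: fermat_rel_def)
  qed
qed

lemma fermat_rel_zero: "(x, y) \<in> fermat_rel n \<Longrightarrow> x 0 = y 0"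
  by (simp add: fermat_rel_def)

lemma little_oh_poly_zero: "little_oh_poly n U x \<Longrightarrow> x 0 \<in> U"
  by (auto simp: little_oh_poly_def)

lemma little_oh_poly_mono: "little_oh_poly n U x \<Longrightarrow> U \<subseteq> V \<Longrightarrow> little_oh_poly n V x"
  unfolding little_oh_poly_def by blast

lemma little_oh_poly_const: "u \<in> U \<Longrightarrow> little_oh_poly n U (\<lambda>_. u)"
  unfolding little_oh_poly_def
  by (intro conjI exI[of _ 1] exI[of _ 0] bexI[of _ u]) auto

lemma std_eq: "little_oh_poly n (Rn n) x \<Longrightarrow> std (fermat_rel n `` {x}) = x 0"
  unfolding std_def
  by (rule the_equality) (auto dest: fermat_rel_zero simp: fermat_rel_def)

lemma little_oh_poly_tendsto:
  assumes "little_oh_poly n V x" "j < n"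
  shows "((\<lambda>t. x t j) \<longlongrightarrow> x 0 j) (at_right 0)"
proof -
  obtain k \<alpha> and a :: "nat \<Rightarrow> real" where a: "\<forall>i\<in>{1..k::nat}. a i > 0"
    and o: "(\<lambda>t. vnorm n (\<lambda>j. x t j - x 0 j - (\<Sum>i=1..k. \<alpha> i j * t powr a i)))
              \<in> o[at_right 0](\<lambda>t. t)"
    using assms unfolding little_oh_poly_def by blast
  let ?e = "\<lambda>t. x t j - x 0 j - (\<Sum>i=1..k. \<alpha> i j * t powr a i)"
  have "?e \<in> o[at_right 0](\<lambda>t. t)"
  proof (rule landau_o.big_small_trans[OF _ o], rule bigoI[where c = 1])
    have "norm (?e t) \<le> 1 * norm (vnorm n (\<lambda>j. x t j - x 0 j - (\<Sum>i=1..k. \<alpha> i j * t powr a i)))" for t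
      using member_le_L2_set[of "{..<n}" j "\<lambda>j. \<bar>x t j - x 0 j - (\<Sum>i=1..k. \<alpha> i j * t powr a i)\<bar>"]
        \<open>j < n\<close> by (simp add: vnorm_def L2_set_def)
    then show "\<forall>\<^sub>F t in at_right 0. norm (?e t) \<le>
        1 * norm (vnorm n (\<lambda>j. x t j - x 0 j - (\<Sum>i=1..k. \<alpha> i j * t powr a i)))"
      by simp
  qed
  moreover have "(\<lambda>t::real. t) \<in> O[at_right 0](\<lambda>_. 1)"
    by (rule bigoI_tendsto[of _ _ 0]) (auto intro!: tendsto_eq_intros)
  ultimately have "?e \<in> o[at_right 0](\<lambda>_. 1)"
    by (rule landau_o.small_big_trans)
  then have e: "(?e \<longlongrightarrow> 0) (at_right 0)"
    by (auto dest: smalloD_tendsto)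
  have "((\<lambda>t::real. \<Sum>i=1..k. \<alpha> i j * t powr a i) \<longlongrightarrow> (\<Sum>i=1..k. \<alpha> i j * 0)) (at_right 0)"
  proof (intro tendsto_intros)
    fix i assume "i \<in> {1..k}"
    with a have "0 < a i" by blast
    then show "((\<lambda>t::real. t powr a i) \<longlongrightarrow> 0) (at_right 0)"
      by (auto intro!: tendsto_eq_intros tendsto_powr' eventually_at_rightI[of 0 1])
  qed
  from tendsto_add[OF tendsto_add[OF e this] tendsto_const[of "x 0 j"]] show ?thesis
    by simp
qed

text \<open>The points of the extension of \<open>U\<close> are the points of the extension of $\mathbb{R}^n$ with
  standard part in \<open>U\<close>.\<close>

lemma fermat_eq_std:
  assumes U: "openin (Euclidean_space n) U"
  shows "fermat n U = {c \<in> fermat n (Rn n). std c \<in> U}"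
proof -
  have sub: "U \<subseteq> Rn n"
    using U by (rule openin_subset)
  have loc: "little_oh_poly n U x" if x: "little_oh_poly n (Rn n) x" and x0: "x 0 \<in> U" for x
  proof -
    obtain W where W: "open W" "U = W \<inter> {x. \<forall>i\<ge>n. x i = 0}"
      using U unfolding Euclidean_space_def openin_subtopology
      by (auto simp: euclidean_product_topology simp flip: open_openin)
    obtain e where e: "e > 0" "\<And>t. t \<in> {0..<e} \<Longrightarrow> x t \<in> Rn n"
      using x unfolding little_oh_poly_def by blast
    have "((\<lambda>t. x t j) \<longlongrightarrow> x 0 j) (at_right 0)" for j
    proof (cases "j < n")
      case True then show ?thesis by (rule little_oh_poly_tendsto[OF x])
    next
      case False
      have "\<forall>\<^sub>F t in at_right 0. x 0 j = x t j"
        using e(1) e(2)[of 0] e(2) False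
        by (auto intro!: eventually_at_rightI[of 0 e] simp: topspace_Euclidean_space)
      then show ?thesis
        by (rule tendsto_eventually[OF eventually_mono]) simp
    qed
    then have "(x \<longlongrightarrow> x 0) (at_right 0)"
      using limitin_componentwise[of "\<lambda>_::nat. euclideanreal" UNIV x "x 0" "at_right 0"]
      by (simp add: euclidean_product_topology limitin_canonical_iff)
    then have "\<forall>\<^sub>F t in at_right 0. x t \<in> W"
      using W x0 by (auto dest: topological_tendstoD)
    then obtain d where d: "d > 0" "\<And>t. 0 < t \<Longrightarrow> t < d \<Longrightarrow> x t \<in> W"
      by (auto simp: eventually_at_right_field)
    have "\<forall>t\<in>{0..<min d e}. x t \<in> U"
    proof
      fix t assume t: "t \<in> {0..<min d e}"
      show "x t \<in> U"
        using t x0 d(2)[of t] e(2)[of t] W(2)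
        by (cases "t = 0") (auto simp: topspace_Euclidean_space)
    qed
    then have "\<exists>e>0. \<forall>t\<in>{0..<e}. x t \<in> U"
      using d(1) e(1) by (intro exI[of _ "min d e"]) auto
    with x x0 show ?thesis
      unfolding little_oh_poly_def by blast
  qed
  show ?thesis
  proof (intro set_eqI iffI)
    fix c assume "c \<in> fermat n U"
    then obtain x where x: "little_oh_poly n U x" "c = fermat_rel n `` {x}"
      by (auto simp: fermat_def elim: quotientE)
    then show "c \<in> {c \<in> fermat n (Rn n). std c \<in> U}"
      using little_oh_poly_mono[OF x(1) sub] little_oh_poly_zero[OF x(1)]
      by (auto simp: fermat_def std_eq intro: quotientI)
  next
    fix c assume c: "c \<in> {c \<in> fermat n (Rn n). std c \<in> U}"
    then obtain x where "little_oh_poly n (Rn n) x" "c = fermat_rel n `` {x}"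
      by (auto simp: fermat_def elim: quotientE)
    with c loc show "c \<in> fermat n U"
      by (auto simp: fermat_def std_eq intro: quotientI)
  qed
qed

lemma fermat_const_in: "u \<in> U \<Longrightarrow> fermat_const n u \<in> fermat n U"
  unfolding fermat_const_def fermat_def
  by (rule quotientI) (simp add: little_oh_poly_const)

lemma fermat_fun_const:
  assumes "u \<in> Rn n" "f u \<in> Rn m" "\<And>v. f v = f u"
  shows "fermat_fun m f (fermat_const n u) = fermat_const m (f u)"
proof -
  have "f \<circ> x = (\<lambda>_. f u)" for x :: "real \<Rightarrow> rvec"
    using assms(3) by (simp add: fun_eq_iff)
  moreover have "(\<lambda>_. u) \<in> fermat_const n u"
    unfolding fermat_const_def
    using equiv_class_self[OF equiv_fermat_rel, of "\<lambda>_. u" n] little_oh_poly_const[OF assms(1)]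
    by auto
  ultimately show ?thesis
    unfolding fermat_fun_def fermat_const_def by auto
qed

lemma equiv_plot_equiv: "equiv UNIV (plot_equiv X)"
  unfolding plot_equiv_def
  by (rule equivI)
    (auto intro!: refl_rtrancl trans_rtrancl sym_rtrancl simp: sym_Un_converse)

lemma Ck_const: "Ck n k U (\<lambda>_. c)"
  by (induction k arbitrary: c) (auto intro!: exI[of _ "\<lambda>_. 0"])

lemma canonical_map_plot:
  assumes X: "diffeological_space X"
    and P: "((n, U), p) \<in> plots X" and u: "u \<in> U"
  shows "canonical_map X (p u) = plot_class X ((n, U), p) (fermat_const n u)"
proof -
  define z :: rvec where "z = (\<lambda>_. 0)"
  define pt :: "nat \<times> rvec set" where "pt = (0, {z})"
  have top0: "Rn 0 = {z}"
    by (auto simp: topspace_Euclidean_space z_def)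
  have pt: "pt \<in> Obj euclidean_site"
    using openin_topspace[of "Euclidean_space 0"] unfolding top0
    by (simp add: pt_def euclidean_site_def)
  have *: "plot_class X (pt, restrict (\<lambda>_. q v) {z}) (fermat_const 0 z)
             = plot_class X ((m, V), q) (fermat_const m v)"
    if Q: "((m, V), q) \<in> plots X" and v: "v \<in> V" for m V q v
  proof -
    have ob: "(m, V) \<in> Obj euclidean_site" and s: "q \<in> sections X (m, V)"
      using Q by (auto simp: plots_def)
    have sub: "V \<subseteq> Rn m"
      using ob by (auto simp: euclidean_site_def dest: openin_subset)
    have "q v \<in> points X"
      using concrete_sheaf.sections_into[OF X ob] s v by auto
    then have c: "(pt, restrict (\<lambda>_. q v) {z}) \<in> plots X"
      using concrete_sheaf.sections_const[OF X pt] pt by (auto simp: plots_def pt_def)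
    have "((pt, restrict (\<lambda>_. q v) {z}), fermat_const 0 z) \<in> plot_points X"
      using c by (auto simp: plot_points_def pt_def fermat_const_in)
    moreover have "(((m, V), q), fermat_const m v) \<in> plot_points X"
      using Q v by (auto simp: plot_points_def fermat_const_in)
    moreover have "(\<lambda>_. v) \<in> plot_hom (pt, restrict (\<lambda>_. q v) {z}) ((m, V), q)"
      using v by (auto simp: plot_hom_def euclidean_site_def pt_def smooth_map_def Ck_const)
    moreover have "fermat_fun m (\<lambda>_. v) (fermat_const 0 z) = fermat_const m v"
      using v sub by (subst fermat_fun_const) (auto simp: top0)
    ultimately have "((((pt, restrict (\<lambda>_. q v) {z}), fermat_const 0 z)),
        (((m, V), q), fermat_const m v)) \<in> plot_step X"
      unfolding plot_step_def by force
    then have "((((pt, restrict (\<lambda>_. q v) {z}), fermat_const 0 z)),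
        (((m, V), q), fermat_const m v)) \<in> plot_equiv X"
      unfolding plot_equiv_def by blast
    then show ?thesis
      unfolding plot_class_def by (rule equiv_class_eq[OF equiv_plot_equiv])
  qed
  have "plot_class X ((m, V), q) (fermat_const m v) = plot_class X ((n, U), p) (fermat_const n u)"
    if "((m, V), q) \<in> plots X" "v \<in> V" "q v = p u" for m V q v
    using *[OF that(1,2)] *[OF P u] that(3) by simp
  then have "{plot_class X ((m, V), q) (fermat_const m v) | m V q v.
      ((m, V), q) \<in> plots X \<and> v \<in> V \<and> q v = p u} = {plot_class X ((n, U), p) (fermat_const n u)}"
    using P u by blast
  then show ?thesis
    unfolding canonical_map_def by simp
qed

end

theory Submission
  imports Defs
begin

text \<open>
  The map \<open>i\<^sub>X\<close> has a left inverse, because the standard part descends to the Fermat space.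
  Consider the map that evaluates a plot at the standard part, \<open>(p, u) \<mapsto> p (std u)\<close>.  A
  generating step relates \<open>(p, u)\<close> to \<open>(q, F u)\<close>, where \<open>F\<close> is the Fermat extension of a map \<open>f\<close>
  with \<open>q \<circ> f = p\<close>.  An extended map commutes with standard parts (\<open>std_fermat_fun\<close>), so
  \<open>q (std (F u)) = q (f (std u)) = p (std u)\<close>, and evaluation is constant on classes
  (\<open>plot_equiv_std_value\<close>).  On the class of \<open>(p, i\<^sub>U u)\<close> its value is \<open>p u\<close>, since the standard
  part of a constant path is that constant; so two points with the same image under \<open>i\<^sub>X\<close>
  coincide.
\<close>

lemma std_representative:
  assumes "c \<in> fermat n (Rn n)" "x \<in> c"
  shows "std c = x 0"
proof -
  obtain y where y: "little_oh_poly n (Rn n) y" "c = fermat_rel n `` {y}"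
    using assms(1) by (auto simp: fermat_def elim: quotientE)
  with assms(2) have "(y, x) \<in> fermat_rel n"
    by simp
  then show ?thesis
    using y by (simp add: std_eq fermat_rel_zero)
qed

lemma fermat_subset: "U \<subseteq> Rn n \<Longrightarrow> fermat n U \<subseteq> fermat n (Rn n)"
  by (auto simp: fermat_def quotient_def intro: little_oh_poly_mono)

lemma std_fermat_const: "u \<in> Rn n \<Longrightarrow> std (fermat_const n u) = u"
  by (simp add: fermat_const_def std_eq little_oh_poly_const)

text \<open>Standard parts are values at \<open>0\<close>, and composing a path with \<open>f\<close> applies \<open>f\<close> to its value
  there.  The second hypothesis ensures that the union defining \<open>fermat_fun\<close> is a single class,
  which for smooth \<open>f\<close> is automatic.\<close>

lemma std_fermat_fun:
  assumes c: "c \<in> fermat n (Rn n)" and fc: "fermat_fun m f c \<in> fermat m (Rn m)"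
  shows "std (fermat_fun m f c) = f (std c)"
proof -
  obtain y where y: "y \<in> fermat_fun m f c"
    using in_quotient_imp_non_empty[OF equiv_fermat_rel fc[unfolded fermat_def]] by blast
  then obtain x where x: "x \<in> c" "(f \<circ> x, y) \<in> fermat_rel m"
    by (auto simp: fermat_fun_def)
  have "std (fermat_fun m f c) = y 0"
    using fc y by (rule std_representative)
  also have "\<dots> = f (x 0)"
    using fermat_rel_zero[OF x(2)] by simp
  also have "x 0 = std c"
    using std_representative[OF c x(1)] by simp
  finally show ?thesis .
qed

lemma plots_domain_subset: "((n, U), p) \<in> plots X \<Longrightarrow> U \<subseteq> Rn n"
  by (auto simp: plots_def euclidean_site_def dest: openin_subset)

lemma plot_step_std_value:
  assumes "((P, u), (Q, v)) \<in> plot_step X"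
  shows "snd Q (std v) = snd P (std u)"
proof -
  obtain n U p where P: "P = ((n, U), p)"
    by (metis surj_pair)
  obtain m V q where Q: "Q = ((m, V), q)"
    by (metis surj_pair)
  obtain f where plotP: "((n, U), p) \<in> plots X" and u: "u \<in> fermat n U"
    and plotQ: "((m, V), q) \<in> plots X" and v: "v \<in> fermat m V"
    and hom: "\<forall>w\<in>U. q (f w) = p w" and fu: "v = fermat_fun m f u"
    using assms unfolding P Q by (auto simp: plot_step_def plot_points_def plot_hom_def)
  have "std v = f (std u)"
    using std_fermat_fun fermat_subset plots_domain_subset[OF plotP] plots_domain_subset[OF plotQ]
      u v fu by blast
  moreover have "openin (Euclidean_space n) U"
    using plotP by (simp add: plots_def euclidean_site_def)
  then have "std u \<in> U"
    using u fermat_eq_std by blast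
  ultimately show ?thesis
    using hom by (simp add: P Q)
qed

text \<open>This is the left inverse of \<open>i\<^sub>X\<close>, written on representatives.\<close>

lemma plot_equiv_std_value:
  assumes "(a, b) \<in> plot_equiv X"
  shows "snd (fst a) (std (snd a)) = snd (fst b) (std (snd b))"
  using assms unfolding plot_equiv_def
proof (induction rule: rtrancl_induct)
  case (step b c)
  then show ?case
    using plot_step_std_value[of "fst b" "snd b" "fst c" "snd c" X]
      plot_step_std_value[of "fst c" "snd c" "fst b" "snd b" X]
    by auto
qed simp

text \<open>A constant plot on the one-point space $\mathbb{R}^0$ suffices.\<close>

lemma plot_through_point:
  assumes X: "diffeological_space X" and x: "x \<in> points X"
  obtains n U p u where "((n, U), p) \<in> plots X" "u \<in> U" "p u = x"
proof -
  have ob: "(0, Rn 0) \<in> Obj euclidean_site"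
    by (simp add: euclidean_site_def)
  have "((0, Rn 0), restrict (\<lambda>_. x) (Rn 0)) \<in> plots X"
    using concrete_sheaf.sections_const[OF X ob x] ob by (simp add: plots_def)
  moreover have "(\<lambda>_. 0) \<in> Rn 0"
    by (simp add: topspace_Euclidean_space)
  ultimately show ?thesis
    using that by (metis restrict_apply')
qed

theorem proposition5:
  fixes X :: "(rvec, 'a) sheaf_data"
  assumes "diffeological_space X"
  shows "canonical_map X \<in> points X \<rightarrow> points (fermat_ext X) \<and> inj_on (canonical_map X) (points X)"
proof
  show "canonical_map X \<in> points X \<rightarrow> points (fermat_ext X)"
  proof
    fix x assume "x \<in> points X"
    with assms obtain n U p u where P: "((n, U), p) \<in> plots X" and u: "u \<in> U" and x: "p u = x"
      by (rule plot_through_point)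
    have "canonical_map X x = plot_class X ((n, U), p) (fermat_const n u)"
      using canonical_map_plot[OF assms P u] x by simp
    moreover have "(((n, U), p), fermat_const n u) \<in> plot_points X"
      using P u by (simp add: plot_points_def fermat_const_in)
    ultimately show "canonical_map X x \<in> points (fermat_ext X)"
      by (simp add: fermat_ext_def Let_def plot_class_def quotientI)
  qed
  show "inj_on (canonical_map X) (points X)"
  proof (rule inj_onI)
    fix x y assume "x \<in> points X" "y \<in> points X" and eq: "canonical_map X x = canonical_map X y"
    obtain n U p u where P: "((n, U), p) \<in> plots X" and u: "u \<in> U" and x: "p u = x"
      using assms \<open>x \<in> points X\<close> by (rule plot_through_point)
    obtain m V q v where Q: "((m, V), q) \<in> plots X" and v: "v \<in> V" and y: "q v = y"
      using assms \<open>y \<in> points X\<close> by (rule plot_through_point)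
    have "plot_class X ((n, U), p) (fermat_const n u) = plot_class X ((m, V), q) (fermat_const m v)"
      using eq canonical_map_plot[OF assms P u] canonical_map_plot[OF assms Q v] x y by simp
    then have "((((n, U), p), fermat_const n u), (((m, V), q), fermat_const m v)) \<in> plot_equiv X"
      unfolding plot_class_def by (rule eq_equiv_class[OF _ equiv_plot_equiv]) simp
    then have "p (std (fermat_const n u)) = q (std (fermat_const m v))"
      by (auto dest: plot_equiv_std_value)
    then show "x = y"
      using plots_domain_subset[OF P] plots_domain_subset[OF Q] u v x y
      by (simp add: std_fermat_const subset_iff)
  qed
qed

end
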